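(* Given a sample $\mathcal S$, the SAT-based learning algorithm terminates eventually and outputs an LTL formula of minimal size that is consistent with $\mathcal S$.
   Context: Let $\mathcal P$ be a finite nonempty set of atomic propositions. LTL formulas are built from atomic propositions $p \in \mathcal P$ using $\lnot$, $\lor$, the temporal operators $\mathbf{X}$ ("next") and $\mathbf{U}$ ("until"), with derived operators $\land$, $\rightarrow$, $\mathbf{F}\psi \coloneqq \mathit{true}\,\mathbf{U}\,\psi$ ("finally") and $\mathbf{G}\psi \coloneqq \lnot\mathbf{F}\lnot\psi$ ("globally"); they are interpreted over infinite words in $(2^{\mathcal P})^\omega$ with the standard semantics. The size $|\varphi|$ of an LTL formula is its number of (distinct) subformulas, i.e. the number of nodes of its syntax DAG (syntax tree with common subformulas shared). A sample $\mathcal S=(P,N)$ consists of two finite disjoint sets $P,N$ of ultimately periodic words $uv^\omega$ ($u\in(2^{\mathcal P})^*$, $v\in(2^{\mathcal P})^+$), the positive and negative examples. An LTL formula $\varphi$ is consistent with $\mathcal S$ if every word in $P$ satisfies $\varphi$ and no word in $N$ satisfies $\varphi$. The SAT-based learning algorithm, for $n=1,2,3,\dots$, constructs a propositional formula $\Phi_n^{\mathcal S}$ (encoding a syntax DAG with $n$ nodes, whose nodes are labeled by atomic propositions or operators from $\{\land,\lor,\lnot,\rightarrow,\mathbf{F},\mathbf{G},\mathbf{U},\mathbf{X}\}$, together with variables tracking the valuation of each subformula at each position of $uv$ for each example $uv^\omega$, constrained so that the root evaluates to true at position 0 on positive examples and false on negative ones) and checks it with a SAT solver; as soon as $\Phi_n^{\mathcal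 S}$ is satisfiable with a model $v$, it returns the LTL formula $\psi_v$ read off from the encoded syntax DAG. The proof uses that (1) if an LTL formula of size $n$ consistent with $\mathcal S$ exists then $\Phi_n^{\mathcal S}$ is satisfiable, and (2) if $v \models \Phi_n^{\mathcal S}$ then $\psi_v$ has size $n$ and is consistent with $\mathcal S$, together with the existence of a consistent formula for every sample with $P\cap N=\emptyset$. *)

theory Defs
  imports "HOL-Library.Omega_Words_Fun"
begin

section \<open>Linear temporal logic\<close>

(* The finite nonempty set of atomic propositions is the type 'a of class finite. The derived
   operators are constructors because each of them labels a single node of a syntax DAG; the lemma
   derived_operators below shows that they have the meaning of their usual definitions. *)
datatype 'a ltl =
    Prop 'a
  | Neg "'a ltl"
  | Disj "'a ltl" "'a ltl"
  | Conj "'a ltl" "'a ltl"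
  | Impl "'a ltl" "'a ltl"
  | Next "'a ltl"
  | Until "'a ltl" "'a ltl"
  | Finally "'a ltl"
  | Globally "'a ltl"

primrec models :: "'a set word \<Rightarrow> 'a ltl \<Rightarrow> bool" where
  "models w (Prop p) \<longleftrightarrow> p \<in> w 0"
| "models w (Neg \<phi>) \<longleftrightarrow> \<not> models w \<phi>"
| "models w (Disj \<phi> \<psi>) \<longleftrightarrow> models w \<phi> \<or> models w \<psi>"
| "models w (Conj \<phi> \<psi>) \<longleftrightarrow> models w \<phi> \<and> models w \<psi>"
| "models w (Impl \<phi> \<psi>) \<longleftrightarrow> (models w \<phi> \<longrightarrow> models w \<psi>)"
| "models w (Next \<phi>) \<longleftrightarrow> models (suffix 1 w) \<phi>"
| "models w (Until \<phi> \<psi>) \<longleftrightarrow>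
     (\<exists>k. models (suffix k w) \<psi> \<and> (\<forall>j<k. models (suffix j w) \<phi>))"
| "models w (Finally \<phi>) \<longleftrightarrow> (\<exists>k. models (suffix k w) \<phi>)"
| "models w (Globally \<phi>) \<longleftrightarrow> (\<forall>k. models (suffix k w) \<phi>)"

lemma derived_operators:
  "models w (Conj \<phi> \<psi>) \<longleftrightarrow> models w (Neg (Disj (Neg \<phi>) (Neg \<psi>)))"
  "models w (Impl \<phi> \<psi>) \<longleftrightarrow> models w (Disj (Neg \<phi>) \<psi>)"
  "models w (Finally \<phi>) \<longleftrightarrow> models w (Until (Disj (Prop p) (Neg (Prop p))) \<phi>)"
  "models w (Globally \<phi>) \<longleftrightarrow> models w (Neg (Finally (Neg \<phi>)))"
  by auto

primrec subformulas :: "'a ltl \<Rightarrow> 'a ltl set" where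
  "subformulas (Prop p) = {Prop p}"
| "subformulas (Neg \<phi>) = insert (Neg \<phi>) (subformulas \<phi>)"
| "subformulas (Disj \<phi> \<psi>) = insert (Disj \<phi> \<psi>) (subformulas \<phi> \<union> subformulas \<psi>)"
| "subformulas (Conj \<phi> \<psi>) = insert (Conj \<phi> \<psi>) (subformulas \<phi> \<union> subformulas \<psi>)"
| "subformulas (Impl \<phi> \<psi>) = insert (Impl \<phi> \<psi>) (subformulas \<phi> \<union> subformulas \<psi>)"
| "subformulas (Next \<phi>) = insert (Next \<phi>) (subformulas \<phi>)"
| "subformulas (Until \<phi> \<psi>) = insert (Until \<phi> \<psi>) (subformulas \<phi> \<union> subformulas \<psi>)"
| "subformulas (Finally \<phi>) = insert (Finally \<phi>) (subformulas \<phi>)"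
| "subformulas (Globally \<phi>) = insert (Globally \<phi>) (subformulas \<phi>)"

definition ltl_size :: "'a ltl \<Rightarrow> nat" where
  "ltl_size \<phi> = card (subformulas \<phi>)"


section \<open>Samples\<close>

(* A pair (u, v) represents the ultimately periodic word u v^omega. *)
type_synonym 'a lasso = "'a set list \<times> 'a set list"
type_synonym 'a sample = "'a lasso set \<times> 'a lasso set"

fun lasso_word :: "'a lasso \<Rightarrow> 'a set word" where
  "lasso_word (u, v) = u \<frown> v\<^sup>\<omega>"

(* Disjointness concerns the words: the same word has many representations (u, v). *)
fun is_sample :: "'a sample \<Rightarrow> bool" where
  "is_sample (P, N) \<longleftrightarrow>
     finite P \<and> finite N \<and> (\<forall>(u, v) \<in> P \<union> N. v \<noteq> []) \<and>
     lasso_word ` P \<inter> lasso_word ` N = {}"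

fun consistent :: "'a ltl \<Rightarrow> 'a sample \<Rightarrow> bool" where
  "consistent \<phi> (P, N) \<longleftrightarrow>
     (\<forall>x \<in> P. models (lasso_word x) \<phi>) \<and> (\<forall>x \<in> N. \<not> models (lasso_word x) \<phi>)"


section \<open>Propositional logic\<close>

datatype 'x pform =
    PVar 'x
  | PTrue
  | PFalse
  | PNot "'x pform" ("\<^bold>\<not> _" [40] 40)
  | PAnd "'x pform" "'x pform" (infixr "\<^bold>\<and>" 35)
  | POr "'x pform" "'x pform" (infixr "\<^bold>\<or>" 30)
  | PImp "'x pform" "'x pform" (infixr "\<^bold>\<longrightarrow>" 25)
  | PIff "'x pform" "'x pform" (infixr "\<^bold>\<longleftrightarrow>" 25)

primrec psat :: "('x \<Rightarrow> bool) \<Rightarrow> 'x pform \<Rightarrow> bool" where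
  "psat \<nu> (PVar x) \<longleftrightarrow> \<nu> x"
| "psat \<nu> PTrue \<longleftrightarrow> True"
| "psat \<nu> PFalse \<longleftrightarrow> False"
| "psat \<nu> (\<^bold>\<not> \<Phi>) \<longleftrightarrow> \<not> psat \<nu> \<Phi>"
| "psat \<nu> (\<Phi> \<^bold>\<and> \<Psi>) \<longleftrightarrow> psat \<nu> \<Phi> \<and> psat \<nu> \<Psi>"
| "psat \<nu> (\<Phi> \<^bold>\<or> \<Psi>) \<longleftrightarrow> psat \<nu> \<Phi> \<or> psat \<nu> \<Psi>"
| "psat \<nu> (\<Phi> \<^bold>\<longrightarrow> \<Psi>) \<longleftrightarrow> (psat \<nu> \<Phi> \<longrightarrow> psat \<nu> \<Psi>)"
| "psat \<nu> (\<Phi> \<^bold>\<longleftrightarrow> \<Psi>) \<longleftrightarrow> (psat \<nu> \<Phi> \<longleftrightarrow> psat \<nu> \<Psi>)"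

(* An arbitrary enumeration; used for finite sets only. *)
definition elems :: "'i set \<Rightarrow> 'i list" where
  "elems I = (SOME xs. set xs = I \<and> distinct xs)"

definition big_and :: "'i set \<Rightarrow> ('i \<Rightarrow> 'x pform) \<Rightarrow> 'x pform" where
  "big_and I f = foldr (\<lambda>i \<Phi>. f i \<^bold>\<and> \<Phi>) (elems I) PTrue"

definition big_or :: "'i set \<Rightarrow> ('i \<Rightarrow> 'x pform) \<Rightarrow> 'x pform" where
  "big_or I f = foldr (\<lambda>i \<Phi>. f i \<^bold>\<or> \<Phi>) (elems I) PFalse"

syntax
  "_big_and" :: "pttrn \<Rightarrow> 'i set \<Rightarrow> 'x pform \<Rightarrow> 'x pform" ("(3\<^bold>\<And>_\<in>_./ _)" [0, 0, 10] 10)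
  "_big_or" :: "pttrn \<Rightarrow> 'i set \<Rightarrow> 'x pform \<Rightarrow> 'x pform" ("(3\<^bold>\<Or>_\<in>_./ _)" [0, 0, 10] 10)
translations
  "\<^bold>\<And>i\<in>I. \<Phi>" \<rightleftharpoons> "CONST big_and I (\<lambda>i. \<Phi>)"
  "\<^bold>\<Or>i\<in>I. \<Phi>" \<rightleftharpoons> "CONST big_or I (\<lambda>i. \<Phi>)"

lemma set_elems: "finite I \<Longrightarrow> set (elems I) = I"
  unfolding elems_def by (drule finite_distinct_list, drule someI_ex) simp

lemma psat_big_and [simp]: "finite I \<Longrightarrow> psat \<nu> (big_and I f) \<longleftrightarrow> (\<forall>i\<in>I. psat \<nu> (f i))"
proof -
  have "psat \<nu> (foldr (\<lambda>i \<Phi>. f i \<^bold>\<and> \<Phi>) xs PTrue) \<longleftrightarrow> (\<forall>i\<in>set xs. psat \<nu> (f i))" for xs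
    by (induction xs) auto
  then show "finite I \<Longrightarrow> ?thesis" by (simp add: big_and_def set_elems)
qed

lemma psat_big_or [simp]: "finite I \<Longrightarrow> psat \<nu> (big_or I f) \<longleftrightarrow> (\<exists>i\<in>I. psat \<nu> (f i))"
proof -
  have "psat \<nu> (foldr (\<lambda>i \<Phi>. f i \<^bold>\<or> \<Phi>) xs PFalse) \<longleftrightarrow> (\<exists>i\<in>set xs. psat \<nu> (f i))" for xs
    by (induction xs) auto
  then show "finite I \<Longrightarrow> ?thesis" by (simp add: big_or_def set_elems)
qed

(* A sound and complete SAT solver; None means unsatisfiable. *)
definition correct_solver :: "('x pform \<Rightarrow> ('x \<Rightarrow> bool) option) \<Rightarrow> bool" where
  "correct_solver solve \<longleftrightarrow>
     (\<forall>\<Phi>. case solve \<Phi> of Some \<nu> \<Rightarrow> psat \<nu> \<Phi> | None \<Rightarrow> \<not> (\<exists>\<nu>. psat \<nu> \<Phi>))"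


section \<open>The encoding\<close>

datatype 'a label =
  LProp 'a | LNeg | LDisj | LConj | LImpl | LNext | LUntil | LFinally | LGlobally

instance label :: (finite) finite
proof
  let ?A = "range LProp \<union> {LNeg, LDisj, LConj, LImpl, LNext, LUntil, LFinally, LGlobally} :: 'a label set"
  have "x \<in> ?A" for x
    by (cases x) simp_all
  then have "UNIV \<subseteq> ?A"
    by (rule subsetI)
  moreover have "finite ?A"
    by simp
  ultimately show "finite (UNIV :: 'a label set)"
    by (rule finite_subset)
qed

(* The nodes of the DAG are 1, ..., n; node n is the root and children have smaller numbers.
   VX i k: node i has label k.   VL i j and VR i j: j is the left (right) child of node i.
   VY u v i t: the subformula at node i holds in u v^omega from position t < |uv| on. *)
datatype 'a enc_var =
    VX nat "'a label"
  | VL nat nat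
  | VR nat nat
  | VY "'a set list" "'a set list" nat nat

(* Every node i > 1 has exactly one left and one right child; the constraints below ignore
   the superfluous ones at nodes whose label has smaller arity. *)
definition child_constraint :: "(nat \<Rightarrow> nat \<Rightarrow> 'a enc_var) \<Rightarrow> nat \<Rightarrow> 'a enc_var pform" where
  "child_constraint C n =
     ((\<^bold>\<And>i\<in>{2..n}. \<^bold>\<Or>j\<in>{1..<i}. PVar (C i j)) \<^bold>\<and>
      (\<^bold>\<And>i\<in>{2..n}. \<^bold>\<And>j\<in>{1..<i}. \<^bold>\<And>j'\<in>{j<..<i}. \<^bold>\<not> PVar (C i j) \<^bold>\<or> \<^bold>\<not> PVar (C i j')))"

definition dag_constraint :: "nat \<Rightarrow> 'a::finite enc_var pform" where
  "dag_constraint n =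
     ((\<^bold>\<And>i\<in>{1..n}. \<^bold>\<Or>k\<in>UNIV. PVar (VX i k)) \<^bold>\<and>
      (\<^bold>\<And>i\<in>{1..n}. \<^bold>\<And>k\<in>UNIV. \<^bold>\<And>k'\<in>UNIV - {k}. \<^bold>\<not> PVar (VX i k) \<^bold>\<or> \<^bold>\<not> PVar (VX i k')) \<^bold>\<and>
      child_constraint VL n \<^bold>\<and>
      child_constraint VR n \<^bold>\<and>
      (\<^bold>\<Or>p\<in>UNIV. PVar (VX 1 (LProp p))))"

(* The positions of uv that occur at or after position t when v is repeated forever. *)
definition future :: "'a set list \<Rightarrow> 'a set list \<Rightarrow> nat \<Rightarrow> nat set" where
  "future u v t = {min t (length u)..<length (u @ v)}"

(* The positions passed on the way from t to the next occurrence of t', excluding t'. *)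
definition between :: "'a set list \<Rightarrow> 'a set list \<Rightarrow> nat \<Rightarrow> nat \<Rightarrow> nat set" where
  "between u v t t' =
     (if t \<le> t' then {t..<t'} else {length u..<t'} \<union> {t..<length (u @ v)})"

definition prop_constraint :: "nat \<Rightarrow> 'a set list \<Rightarrow> 'a set list \<Rightarrow> 'a::finite enc_var pform" where
  "prop_constraint n u v =
     (\<^bold>\<And>i\<in>{1..n}. \<^bold>\<And>p\<in>UNIV. PVar (VX i (LProp p)) \<^bold>\<longrightarrow>
        (\<^bold>\<And>t\<in>{..<length (u @ v)}.
           if p \<in> (u @ v) ! t then PVar (VY u v i t) else \<^bold>\<not> PVar (VY u v i t)))"

definition unary_constraint ::
  "'a label \<Rightarrow> (nat \<Rightarrow> nat \<Rightarrow> 'a enc_var pform) \<Rightarrow>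
   nat \<Rightarrow> 'a set list \<Rightarrow> 'a set list \<Rightarrow> 'a enc_var pform" where
  "unary_constraint k rhs n u v =
     (\<^bold>\<And>i\<in>{2..n}. \<^bold>\<And>j\<in>{1..<i}. PVar (VX i k) \<^bold>\<and> PVar (VL i j) \<^bold>\<longrightarrow>
        (\<^bold>\<And>t\<in>{..<length (u @ v)}. PVar (VY u v i t) \<^bold>\<longleftrightarrow> rhs j t))"

definition binary_constraint ::
  "'a label \<Rightarrow> (nat \<Rightarrow> nat \<Rightarrow> nat \<Rightarrow> 'a enc_var pform) \<Rightarrow>
   nat \<Rightarrow> 'a set list \<Rightarrow> 'a set list \<Rightarrow> 'a enc_var pform" where
  "binary_constraint k rhs n u v =
     (\<^bold>\<And>i\<in>{2..n}. \<^bold>\<And>j\<in>{1..<i}. \<^bold>\<And>j'\<in>{1..<i}.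
        PVar (VX i k) \<^bold>\<and> PVar (VL i j) \<^bold>\<and> PVar (VR i j') \<^bold>\<longrightarrow>
        (\<^bold>\<And>t\<in>{..<length (u @ v)}. PVar (VY u v i t) \<^bold>\<longleftrightarrow> rhs j j' t))"

definition word_constraint :: "nat \<Rightarrow> 'a set list \<Rightarrow> 'a set list \<Rightarrow> 'a::finite enc_var pform" where
  "word_constraint n u v =
     (let y = (\<lambda>j t. PVar (VY u v j t)) in
      prop_constraint n u v \<^bold>\<and>
      unary_constraint LNeg (\<lambda>j t. \<^bold>\<not> y j t) n u v \<^bold>\<and>
      binary_constraint LDisj (\<lambda>j j' t. y j t \<^bold>\<or> y j' t) n u v \<^bold>\<and>
      binary_constraint LConj (\<lambda>j j' t. y j t \<^bold>\<and> y j' t) n u v \<^bold>\<and>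
      binary_constraint LImpl (\<lambda>j j' t. y j t \<^bold>\<longrightarrow> y j' t) n u v \<^bold>\<and>
      unary_constraint LNext
        (\<lambda>j t. y j (if t + 1 < length (u @ v) then t + 1 else length u)) n u v \<^bold>\<and>
      binary_constraint LUntil
        (\<lambda>j j' t. \<^bold>\<Or>t'\<in>future u v t. y j' t' \<^bold>\<and> (\<^bold>\<And>t''\<in>between u v t t'. y j t'')) n u v \<^bold>\<and>
      unary_constraint LFinally (\<lambda>j t. \<^bold>\<Or>t'\<in>future u v t. y j t') n u v \<^bold>\<and>
      unary_constraint LGlobally (\<lambda>j t. \<^bold>\<And>t'\<in>future u v t. y j t') n u v)"

fun encoding :: "nat \<Rightarrow> 'a::finite sample \<Rightarrow> 'a enc_var pform" where
  "encoding n (P, N) =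
     (dag_constraint n \<^bold>\<and>
      (\<^bold>\<And>(u, v)\<in>P. word_constraint n u v \<^bold>\<and> PVar (VY u v n 0)) \<^bold>\<and>
      (\<^bold>\<And>(u, v)\<in>N. word_constraint n u v \<^bold>\<and> \<^bold>\<not> PVar (VY u v n 0)))"


section \<open>The learning algorithm\<close>

(* node_formula \<nu> i \<phi>: \<phi> is the formula at node i of the DAG described by the valuation \<nu>. *)
inductive node_formula :: "('a enc_var \<Rightarrow> bool) \<Rightarrow> nat \<Rightarrow> 'a ltl \<Rightarrow> bool" for \<nu> where
  "\<nu> (VX i (LProp p)) \<Longrightarrow> node_formula \<nu> i (Prop p)"
| "\<lbrakk>\<nu> (VX i LNeg); j \<in> {1..<i}; \<nu> (VL i j); node_formula \<nu> j \<phi>\<rbrakk> \<Longrightarrow> node_formula \<nu> i (Neg \<phi>)"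
| "\<lbrakk>\<nu> (VX i LDisj); j \<in> {1..<i}; \<nu> (VL i j); node_formula \<nu> j \<phi>;
    j' \<in> {1..<i}; \<nu> (VR i j'); node_formula \<nu> j' \<psi>\<rbrakk> \<Longrightarrow> node_formula \<nu> i (Disj \<phi> \<psi>)"
| "\<lbrakk>\<nu> (VX i LConj); j \<in> {1..<i}; \<nu> (VL i j); node_formula \<nu> j \<phi>;
    j' \<in> {1..<i}; \<nu> (VR i j'); node_formula \<nu> j' \<psi>\<rbrakk> \<Longrightarrow> node_formula \<nu> i (Conj \<phi> \<psi>)"
| "\<lbrakk>\<nu> (VX i LImpl); j \<in> {1..<i}; \<nu> (VL i j); node_formula \<nu> j \<phi>;
    j' \<in> {1..<i}; \<nu> (VR i j'); node_formula \<nu> j' \<psi>\<rbrakk> \<Longrightarrow> node_formula \<nu> i (Impl \<phi> \<psi>)"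
| "\<lbrakk>\<nu> (VX i LNext); j \<in> {1..<i}; \<nu> (VL i j); node_formula \<nu> j \<phi>\<rbrakk> \<Longrightarrow> node_formula \<nu> i (Next \<phi>)"
| "\<lbrakk>\<nu> (VX i LUntil); j \<in> {1..<i}; \<nu> (VL i j); node_formula \<nu> j \<phi>;
    j' \<in> {1..<i}; \<nu> (VR i j'); node_formula \<nu> j' \<psi>\<rbrakk> \<Longrightarrow> node_formula \<nu> i (Until \<phi> \<psi>)"
| "\<lbrakk>\<nu> (VX i LFinally); j \<in> {1..<i}; \<nu> (VL i j); node_formula \<nu> j \<phi>\<rbrakk>
    \<Longrightarrow> node_formula \<nu> i (Finally \<phi>)"
| "\<lbrakk>\<nu> (VX i LGlobally); j \<in> {1..<i}; \<nu> (VL i j); node_formula \<nu> j \<phi>\<rbrakk>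
    \<Longrightarrow> node_formula \<nu> i (Globally \<phi>)"

definition decode :: "nat \<Rightarrow> ('a enc_var \<Rightarrow> bool) \<Rightarrow> 'a ltl" where
  "decode n \<nu> = (THE \<phi>. node_formula \<nu> n \<phi>)"

(* The result None means that the loop does not terminate. *)
partial_function (option) learn_from ::
  "('a::finite enc_var pform \<Rightarrow> ('a enc_var \<Rightarrow> bool) option) \<Rightarrow> 'a sample \<Rightarrow> nat \<Rightarrow> 'a ltl option" where
  "learn_from solve S n =
     (case solve (encoding n S) of
        Some \<nu> \<Rightarrow> Some (decode n \<nu>)
      | None \<Rightarrow> learn_from solve S (n + 1))"

definition learn ::
  "('a::finite enc_var pform \<Rightarrow> ('a enc_var \<Rightarrow> bool) option) \<Rightarrow> 'a sample \<Rightarrow> 'a ltl option" where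
  "learn solve S = learn_from solve S 1"

end

(* A model of the encoding of size n describes a DAG whose n nodes carry all subformulas of the
   decoded formula, so this formula has size at most n. Conversely, listing the subformulas of a
   formula of size n by increasing syntactic size puts children before parents and the root last,
   which yields a model of the encoding of size n. The valuation variables agree with the semantics
   because a lasso has only finitely many distinct suffixes: a shortest witness of an until formula
   runs through each position of u v at most once. The first satisfiable encoding therefore gives a
   consistent formula of minimal size, and one is satisfiable because the formulas X^k p and
   their negations separate any two distinct words. *)
theory Submission
  imports Defs
begin

section \<open>Semantics on lassos\<close>

lemma finite_future [simp]: "finite (future u v t)"
  by (simp add: future_def)

lemma finite_between [simp]: "finite (between u v t t')"
  by (simp add: between_def)

text \<open>From \<open>length u\<close> on, truth values repeat with period
  \<open>length v\<close>. A first witness is therefore either inside \<open>uv\<close> or a copy,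
  one period later, of a position before \<open>t\<close>; conversely, a position
  \<open>t' < t\<close> in \<open>future\<close> is met again at \<open>t' + length v\<close>.
  Keeping \<open>A\<close> and \<open>B\<close> abstract makes the other operators
  instances.\<close>

lemma until_lasso:
  assumes perA: "\<And>k. length u \<le> k \<Longrightarrow> A (k + length v) = A k"
    and perB: "\<And>k. length u \<le> k \<Longrightarrow> B (k + length v) = B k"
    and "v \<noteq> []" and t: "t < length (u @ v)"
  shows "(\<exists>k. B (t + k) \<and> (\<forall>j<k. A (t + j))) \<longleftrightarrow>
         (\<exists>t'\<in>future u v t. B t' \<and> (\<forall>t''\<in>between u v t t'. A t''))" (is "?L \<longleftrightarrow> ?R")
proof
  assume ?L
  then have ex: "\<exists>k. B (t + k)" by blast
  \<comment> \<open>Leastness of \<open>k\<close> is what limits the run to at most one wrap from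
    the end of \<open>uv\<close> back to \<open>length u\<close>.\<close>
  define k where "k = (LEAST k. B (t + k))"
  have Bk: "B (t + k)" unfolding k_def using ex by (rule LeastI_ex)
  have least: "\<not> B (t + j)" if "j < k" for j
    using that not_less_Least unfolding k_def by blast
  from \<open>?L\<close> obtain k0 where "B (t + k0)" "\<forall>j<k0. A (t + j)" by blast
  then have Aj: "A (t + j)" if "j < k" for j
    using that least by (meson linorder_not_less order.strict_trans2)
  have A': "A x" if "t \<le> x" "x < t + k" for x
    using Aj[of "x - t"] that by simp
  have pos: "0 < length v" using \<open>v \<noteq> []\<close> by simp
  show ?R
  proof (cases "t + k < length (u @ v)")
    case True
    then show ?thesis
      using Bk A' by (intro bexI[of _ "t + k"]) (auto simp: between_def future_def)
  next
    case False
    define t' where "t' = t + k - length v"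
    have tk: "t + k = t' + length v" and t'_ge: "length u \<le> t'"
      using False by (simp_all add: t'_def)
    have B': "B t'" using Bk perB[OF t'_ge] by (simp add: tk)
    \<comment> \<open>Otherwise \<open>t' - t\<close> would be an offset smaller than
      \<open>k\<close> at which \<open>B\<close> holds.\<close>
    have "t' < t"
    proof (rule ccontr)
      assume "\<not> t' < t"
      then have "t + (t' - t) = t'" "t' - t < k" using tk pos by linarith+
      then show False using least B' by metis
    qed
    \<comment> \<open>Here \<open>x\<close> stands for its copy \<open>x + length v\<close>, which
      lies between \<open>t\<close> and \<open>t + k\<close>.\<close>
    moreover have "A x" if "length u \<le> x" "x < t'" for x
      using A'[of "x + length v"] perA[of x] that t tk by simp
    moreover have "A x" if "t \<le> x" "x < length (u @ v)" for x
      using A'[of x] that False by simp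
    ultimately show ?thesis
      using B' t'_ge t by (intro bexI[of _ t']) (auto simp: between_def future_def)
  qed
next
  assume ?R
  then obtain t' where t': "t' \<in> future u v t" "B t'" and A': "\<And>x. x \<in> between u v t t' \<Longrightarrow> A x"
    by blast
  show ?L
  proof (cases "t \<le> t'")
    case True
    then show ?thesis
      using t' A' by (intro exI[of _ "t' - t"]) (auto simp: between_def)
  next
    case False
    then have l: "length u \<le> t'" using t'(1) by (auto simp: future_def)
    \<comment> \<open>Past the end of \<open>uv\<close> the run meets copies of positions from
      \<open>length u\<close> on; shifting back by \<open>length v\<close> brings them into
      \<open>between\<close>.\<close>
    have "A (t + j)" if "t + j < t' + length v" for j
    proof (cases "t + j < length (u @ v)")
      case True
      then show ?thesis using A'[of "t + j"] False by (simp add: between_def)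
    next
      case ge: False
      then have "length u \<le> t + j - length v" "t + j - length v + length v = t + j"
        "t + j - length v < t'"
        using that by auto
      then show ?thesis
        using A'[of "t + j - length v"] perA[of "t + j - length v"] False
        by (simp add: between_def)
    qed
    then show ?thesis
      using perB[OF l] t' False t l by (intro exI[of _ "t' + length v - t"]) auto
  qed
qed

lemma eventually_lasso:
  assumes "\<And>k. length u \<le> k \<Longrightarrow> B (k + length v) = B k"
    and "v \<noteq> []" and "t < length (u @ v)"
  shows "(\<exists>k. B (t + k)) \<longleftrightarrow> (\<exists>t'\<in>future u v t. B t')"
  using until_lasso[of u "\<lambda>_. True" v B t] assms by simp

lemma always_lasso:
  assumes "\<And>k. length u \<le> k \<Longrightarrow> B (k + length v) = B k"
    and "v \<noteq> []" and "t < length (u @ v)"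
  shows "(\<forall>k. B (t + k)) \<longleftrightarrow> (\<forall>t'\<in>future u v t. B t')"
  using eventually_lasso[of u "\<lambda>k. \<not> B k" v t] assms by simp blast

section \<open>Periodicity of lassos and the operators at a position of \<open>uv\<close>\<close>

lemma lasso_word_nth: "t < length (u @ v) \<Longrightarrow> lasso_word (u, v) t = (u @ v) ! t"
  by (auto simp: conc_def iter_def nth_append)

text \<open>Past \<open>u\<close>, a letter depends only on its distance from
  \<open>length u\<close> modulo \<open>length v\<close>. This supplies the periodicity assumed in
  \<open>until_lasso\<close> and its instances.\<close>

lemma suffix_lasso_period:
  "length u \<le> k \<Longrightarrow> suffix (k + length v) (lasso_word (u, v)) = suffix k (lasso_word (u, v))"
proof (rule ext)
  fix i
  assume "length u \<le> k"
  then have "k + length v + i - length u = (k + i - length u) + length v"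
    by simp
  then have "(k + length v + i - length u) mod length v = (k + i - length u) mod length v"
    by (metis mod_add_self2)
  with \<open>length u \<le> k\<close> show "suffix (k + length v) (lasso_word (u, v)) i = suffix k (lasso_word (u, v)) i"
    by (simp add: conc_def iter_def suffix_def)
qed

lemma models_at_until:
  assumes "v \<noteq> []" "t < length (u @ v)"
  shows "models (suffix t (lasso_word (u, v))) (Until \<phi> \<psi>) \<longleftrightarrow>
    (\<exists>t'\<in>future u v t. models (suffix t' (lasso_word (u, v))) \<psi> \<and>
       (\<forall>t''\<in>between u v t t'. models (suffix t'' (lasso_word (u, v))) \<phi>))"
  using until_lasso[of u "\<lambda>k. models (suffix k (lasso_word (u, v))) \<phi>" v
      "\<lambda>k. models (suffix k (lasso_word (u, v))) \<psi>" t] assms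
  by (simp add: suffix_lasso_period del: lasso_word.simps)

lemma models_at_finally:
  assumes "v \<noteq> []" "t < length (u @ v)"
  shows "models (suffix t (lasso_word (u, v))) (Finally \<phi>) \<longleftrightarrow>
    (\<exists>t'\<in>future u v t. models (suffix t' (lasso_word (u, v))) \<phi>)"
  using eventually_lasso[of u "\<lambda>k. models (suffix k (lasso_word (u, v))) \<phi>" v t] assms
  by (simp add: suffix_lasso_period del: lasso_word.simps)

lemma models_at_globally:
  assumes "v \<noteq> []" "t < length (u @ v)"
  shows "models (suffix t (lasso_word (u, v))) (Globally \<phi>) \<longleftrightarrow>
    (\<forall>t'\<in>future u v t. models (suffix t' (lasso_word (u, v))) \<phi>)"
  using always_lasso[of u "\<lambda>k. models (suffix k (lasso_word (u, v))) \<phi>" v t] assms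
  by (simp add: suffix_lasso_period del: lasso_word.simps)

lemma models_at_next:
  assumes "t < length (u @ v)"
  shows "models (suffix t (lasso_word (u, v))) (Next \<phi>) \<longleftrightarrow>
    models (suffix (if t + 1 < length (u @ v) then t + 1 else length u) (lasso_word (u, v))) \<phi>"
proof (cases "t + 1 < length (u @ v)")
  case False
  \<comment> \<open>Here \<open>t\<close> is the last position of \<open>uv\<close>; its successor
    lies one period after \<open>length u\<close> and has the same suffix.\<close>
  then have "t + 1 = length u + length v" using assms by simp
  then show ?thesis
    using suffix_lasso_period[of u "length u" v] False by (simp del: lasso_word.simps)
qed (simp del: lasso_word.simps)

lemma models_at_prop:
  "t < length (u @ v) \<Longrightarrow>
    models (suffix t (lasso_word (u, v))) (Prop p) \<longleftrightarrow> p \<in> (u @ v) ! t"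
  using lasso_word_nth[of t u v] by (simp del: lasso_word.simps)


section \<open>Soundness of the encoding\<close>

lemma psat_prop_constraint:
  "psat \<nu> (prop_constraint n u v) \<longleftrightarrow>
    (\<forall>i\<in>{1..n}. \<forall>p. \<nu> (VX i (LProp p)) \<longrightarrow>
       (\<forall>t<length (u @ v). \<nu> (VY u v i t) \<longleftrightarrow> p \<in> (u @ v) ! t))"
proof -
  have "psat \<nu> (if b then PVar x else \<^bold>\<not> PVar x) \<longleftrightarrow> (\<nu> x \<longleftrightarrow> b)" for b x
    by simp
  then show ?thesis
    unfolding prop_constraint_def by (simp add: Ball_def)
qed

lemma psat_unary_constraint:
  "psat \<nu> (unary_constraint k rhs n u v) \<longleftrightarrow>
    (\<forall>i\<in>{2..n}. \<forall>j\<in>{1..<i}. \<nu> (VX i k) \<and> \<nu> (VL i j) \<longrightarrow>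
       (\<forall>t<length (u @ v). \<nu> (VY u v i t) \<longleftrightarrow> psat \<nu> (rhs j t)))"
  unfolding unary_constraint_def by (simp add: Ball_def)

lemma psat_binary_constraint:
  "psat \<nu> (binary_constraint k rhs n u v) \<longleftrightarrow>
    (\<forall>i\<in>{2..n}. \<forall>j\<in>{1..<i}. \<forall>j'\<in>{1..<i}. \<nu> (VX i k) \<and> \<nu> (VL i j) \<and> \<nu> (VR i j') \<longrightarrow>
       (\<forall>t<length (u @ v). \<nu> (VY u v i t) \<longleftrightarrow> psat \<nu> (rhs j j' t)))"
  unfolding binary_constraint_def by (simp add: Ball_def)

lemmas psat_word_constraint =
  psat_prop_constraint psat_unary_constraint psat_binary_constraint

lemma psat_child_constraint:
  "psat \<nu> (child_constraint C n) \<longleftrightarrow> (\<forall>i\<in>{2..n}. \<exists>!j. j \<in> {1..<i} \<and> \<nu> (C i j))"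
proof -
  have "psat \<nu> (child_constraint C n) \<longleftrightarrow> (\<forall>i\<in>{2..n}. (\<exists>j\<in>{1..<i}. \<nu> (C i j)) \<and>
      (\<forall>j\<in>{1..<i}. \<forall>j'\<in>{j<..<i}. \<not> \<nu> (C i j) \<or> \<not> \<nu> (C i j')))"
    unfolding child_constraint_def by (simp add: ball_conj_distrib)
  also have "\<dots> \<longleftrightarrow> (\<forall>i\<in>{2..n}. \<exists>!j. j \<in> {1..<i} \<and> \<nu> (C i j))"
  proof (intro ball_cong refl iffI)
    fix i
    assume *: "(\<exists>j\<in>{1..<i}. \<nu> (C i j)) \<and>
      (\<forall>j\<in>{1..<i}. \<forall>j'\<in>{j<..<i}. \<not> \<nu> (C i j) \<or> \<not> \<nu> (C i j'))"
    \<comment> \<open>The encoding excludes pairs in increasing order only; the order cases restore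
      symmetry.\<close>
    have "j = j'" if "j \<in> {1..<i}" "j' \<in> {1..<i}" "\<nu> (C i j)" "\<nu> (C i j')" for j j'
      using * that by (cases j j' rule: linorder_cases) auto
    with * show "\<exists>!j. j \<in> {1..<i} \<and> \<nu> (C i j)" by blast
  next
    fix i
    assume *: "\<exists>!j. j \<in> {1..<i} \<and> \<nu> (C i j)"
    then have "False" if "j \<in> {1..<i}" "j' \<in> {j<..<i}" "\<nu> (C i j)" "\<nu> (C i j')" for j j'
    proof -
      have "j' \<in> {1..<i}" "j \<noteq> j'" using that by auto
      then show False using * that by blast
    qed
    with * show "(\<exists>j\<in>{1..<i}. \<nu> (C i j)) \<and>
      (\<forall>j\<in>{1..<i}. \<forall>j'\<in>{j<..<i}. \<not> \<nu> (C i j) \<or> \<not> \<nu> (C i j'))" by blast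
  qed
  finally show ?thesis .
qed

lemma psat_dag_constraint:
  "psat \<nu> (dag_constraint n) \<longleftrightarrow>
    (\<forall>i\<in>{1..n}. \<exists>!k. \<nu> (VX i k)) \<and>
    (\<forall>i\<in>{2..n}. \<exists>!j. j \<in> {1..<i} \<and> \<nu> (VL i j)) \<and>
    (\<forall>i\<in>{2..n}. \<exists>!j. j \<in> {1..<i} \<and> \<nu> (VR i j)) \<and>
    (\<exists>p. \<nu> (VX 1 (LProp p)))"
proof -
  have "(\<forall>i\<in>{1..n}. \<exists>!k. \<nu> (VX i k)) \<longleftrightarrow>
      (\<forall>i\<in>{1..n}. \<exists>k. \<nu> (VX i k)) \<and>
      (\<forall>i\<in>{1..n}. \<forall>k. \<forall>k'\<in>UNIV - {k}. \<not> \<nu> (VX i k) \<or> \<not> \<nu> (VX i k'))"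
    by blast
  then show ?thesis
    unfolding dag_constraint_def by (simp add: psat_child_constraint)
qed

section \<open>The formula at each node of the DAG\<close>

lemma node_formula_unique:
  assumes "psat \<nu> (dag_constraint n)" "node_formula \<nu> i \<phi>" "i \<in> {1..n}" "node_formula \<nu> i \<phi>'"
  shows "\<phi> = \<phi>'"
proof -
  have X: "k = k'" if "i \<in> {1..n}" "\<nu> (VX i k)" "\<nu> (VX i k')" for i k k'
    using that assms(1) unfolding psat_dag_constraint by blast
  \<comment> \<open>A node with a child is not node 1, so the uniqueness of children, stated from
    node 2 on, applies.\<close>
  have i2: "i \<in> {2..n}" if "i \<in> {1..n}" "j \<in> {1..<i}" for i j
    using that by auto
  have L: "j = j'" if "i \<in> {1..n}" "j \<in> {1..<i}" "j' \<in> {1..<i}" "\<nu> (VL i j)" "\<nu> (VL i j')" for i j j'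
    using that i2[OF that(1,2)] assms(1) unfolding psat_dag_constraint by blast
  have R: "j = j'" if "i \<in> {1..n}" "j \<in> {1..<i}" "j' \<in> {1..<i}" "\<nu> (VR i j)" "\<nu> (VR i j')" for i j j'
    using that i2[OF that(1,2)] assms(1) unfolding psat_dag_constraint by blast
  have sub: "j \<in> {1..n}" if "i \<in> {1..n}" "j \<in> {1..<i}" for i j
    using that by auto
  show ?thesis
    using assms(2-4)
  proof (induction arbitrary: \<phi>' rule: node_formula.induct)
    \<comment> \<open>In every case \<open>X'\<close> fixes the label, so inversion leaves only the
      matching rule; \<open>L'\<close> and \<open>R'\<close> then fix the children and
      \<open>IH\<close> their formulas.\<close>
    case (1 i p)
    note X' = X[OF "1.prems"(1) "1.hyps"]
    from "1.prems"(2) show ?case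
      by cases (blast dest: X')+
  next
    case (2 i j \<phi>)
    note X' = X[OF "2.prems"(1) "2.hyps"(1)]
      and L' = L[OF "2.prems"(1) "2.hyps"(2) _ "2.hyps"(3)]
      and IH = "2.IH"[OF sub[OF "2.prems"(1) "2.hyps"(2)]]
    from "2.prems"(2) show ?case
      by cases (blast dest: X' L' IH)+
  next
    case (3 i j \<phi> j' \<psi>)
    note X' = X[OF "3.prems"(1) "3.hyps"(1)]
      and L' = L[OF "3.prems"(1) "3.hyps"(2) _ "3.hyps"(3)]
      and R' = R[OF "3.prems"(1) "3.hyps"(5) _ "3.hyps"(6)]
      and IH = "3.IH"(1)[OF sub[OF "3.prems"(1) "3.hyps"(2)]]
        "3.IH"(2)[OF sub[OF "3.prems"(1) "3.hyps"(5)]]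
    from "3.prems"(2) show ?case
      by cases (blast dest: X' L' R' IH)+
  next
    case (4 i j \<phi> j' \<psi>)
    note X' = X[OF "4.prems"(1) "4.hyps"(1)]
      and L' = L[OF "4.prems"(1) "4.hyps"(2) _ "4.hyps"(3)]
      and R' = R[OF "4.prems"(1) "4.hyps"(5) _ "4.hyps"(6)]
      and IH = "4.IH"(1)[OF sub[OF "4.prems"(1) "4.hyps"(2)]]
        "4.IH"(2)[OF sub[OF "4.prems"(1) "4.hyps"(5)]]
    from "4.prems"(2) show ?case
      by cases (blast dest: X' L' R' IH)+
  next
    case (5 i j \<phi> j' \<psi>)
    note X' = X[OF "5.prems"(1) "5.hyps"(1)]
      and L' = L[OF "5.prems"(1) "5.hyps"(2) _ "5.hyps"(3)]
      and R' = R[OF "5.prems"(1) "5.hyps"(5) _ "5.hyps"(6)]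
      and IH = "5.IH"(1)[OF sub[OF "5.prems"(1) "5.hyps"(2)]]
        "5.IH"(2)[OF sub[OF "5.prems"(1) "5.hyps"(5)]]
    from "5.prems"(2) show ?case
      by cases (blast dest: X' L' R' IH)+
  next
    case (6 i j \<phi>)
    note X' = X[OF "6.prems"(1) "6.hyps"(1)]
      and L' = L[OF "6.prems"(1) "6.hyps"(2) _ "6.hyps"(3)]
      and IH = "6.IH"[OF sub[OF "6.prems"(1) "6.hyps"(2)]]
    from "6.prems"(2) show ?case
      by cases (blast dest: X' L' IH)+
  next
    case (7 i j \<phi> j' \<psi>)
    note X' = X[OF "7.prems"(1) "7.hyps"(1)]
      and L' = L[OF "7.prems"(1) "7.hyps"(2) _ "7.hyps"(3)]
      and R' = R[OF "7.prems"(1) "7.hyps"(5) _ "7.hyps"(6)]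
      and IH = "7.IH"(1)[OF sub[OF "7.prems"(1) "7.hyps"(2)]]
        "7.IH"(2)[OF sub[OF "7.prems"(1) "7.hyps"(5)]]
    from "7.prems"(2) show ?case
      by cases (blast dest: X' L' R' IH)+
  next
    case (8 i j \<phi>)
    note X' = X[OF "8.prems"(1) "8.hyps"(1)]
      and L' = L[OF "8.prems"(1) "8.hyps"(2) _ "8.hyps"(3)]
      and IH = "8.IH"[OF sub[OF "8.prems"(1) "8.hyps"(2)]]
    from "8.prems"(2) show ?case
      by cases (blast dest: X' L' IH)+
  next
    case (9 i j \<phi>)
    note X' = X[OF "9.prems"(1) "9.hyps"(1)]
      and L' = L[OF "9.prems"(1) "9.hyps"(2) _ "9.hyps"(3)]
      and IH = "9.IH"[OF sub[OF "9.prems"(1) "9.hyps"(2)]]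
    from "9.prems"(2) show ?case
      by cases (blast dest: X' L' IH)+
  qed
qed

text \<open>Children have smaller numbers, which permits strong induction. Node 1 can have no child,
  which is why the encoding forces a proposition there; every later node has both children, whatever
  its label.\<close>

lemma node_formula_exists:
  assumes "psat \<nu> (dag_constraint n)" "i \<in> {1..n}"
  shows "\<exists>\<phi>. node_formula \<nu> i \<phi>"
  using assms(2)
proof (induction i rule: less_induct)
  case (less i)
  show ?case
  proof (cases "i = 1")
    case True
    obtain p where "\<nu> (VX 1 (LProp p))"
      using assms(1) unfolding psat_dag_constraint by blast
    then have "node_formula \<nu> 1 (Prop p)" by (rule node_formula.intros(1))
    then show ?thesis unfolding True by blast
  next
    case False
    with less.prems have i: "i \<in> {2..n}" by auto
    then obtain j j' where j: "j \<in> {1..<i}" "\<nu> (VL i j)" and j': "j' \<in> {1..<i}" "\<nu> (VR i j')"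
      using assms(1) unfolding psat_dag_constraint by blast
    obtain \<phi> \<psi> where "node_formula \<nu> j \<phi>" "node_formula \<nu> j' \<psi>"
      using less.IH[of j] less.IH[of j'] j(1) j'(1) less.prems by auto
    note intros = node_formula.intros(2,6,8,9)[OF _ j this(1)]
      node_formula.intros(3-5,7)[OF _ j this(1) j' this(2)]
    obtain k where "\<nu> (VX i k)"
      using assms(1) less.prems unfolding psat_dag_constraint by blast
    then show ?thesis
      by (cases k) (blast intro: intros node_formula.intros(1))+
  qed
qed

text \<open>Justifies the definite description in \<open>decode\<close>, and at every node rather
  than just the root, so that \<open>decode i \<nu>\<close> names the formula at node
  \<open>i\<close>.\<close>

lemma node_formula_decode:
  assumes "psat \<nu> (dag_constraint n)" "i \<in> {1..n}"
  shows "node_formula \<nu> i \<phi> \<longleftrightarrow> \<phi> = decode i \<nu>"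
proof -
  have "\<exists>!\<phi>. node_formula \<nu> i \<phi>"
    using node_formula_exists[OF assms] node_formula_unique[OF assms(1) _ assms(2)] by blast
  then show ?thesis
    unfolding decode_def by (metis theI')
qed

text \<open>Since children have smaller numbers, the nodes up to \<open>i\<close> carry everything
  that occurs in the formula at \<open>i\<close>; this feeds the size bound.\<close>

lemma subformulas_node_formula:
  "node_formula \<nu> i \<phi> \<Longrightarrow> 1 \<le> i \<Longrightarrow>
    subformulas \<phi> \<subseteq> {\<psi>. \<exists>j\<in>{1..i}. node_formula \<nu> j \<psi>}"
proof (induction rule: node_formula.induct)
  case (1 i p)
  then show ?case using node_formula.intros(1) by fastforce
next
  case (2 i j \<phi>)
  have "node_formula \<nu> i (Neg \<phi>)" by (rule node_formula.intros) fact+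
  with 2 show ?case by fastforce
next
  case (3 i j \<phi> j' \<psi>)
  have "node_formula \<nu> i (Disj \<phi> \<psi>)" by (rule node_formula.intros) fact+
  with 3 show ?case by fastforce
next
  case (4 i j \<phi> j' \<psi>)
  have "node_formula \<nu> i (Conj \<phi> \<psi>)" by (rule node_formula.intros) fact+
  with 4 show ?case by fastforce
next
  case (5 i j \<phi> j' \<psi>)
  have "node_formula \<nu> i (Impl \<phi> \<psi>)" by (rule node_formula.intros) fact+
  with 5 show ?case by fastforce
next
  case (6 i j \<phi>)
  have "node_formula \<nu> i (Next \<phi>)" by (rule node_formula.intros) fact+
  with 6 show ?case by fastforce
next
  case (7 i j \<phi> j' \<psi>)
  have "node_formula \<nu> i (Until \<phi> \<psi>)" by (rule node_formula.intros) fact+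
  with 7 show ?case by fastforce
next
  case (8 i j \<phi>)
  have "node_formula \<nu> i (Finally \<phi>)" by (rule node_formula.intros) fact+
  with 8 show ?case by fastforce
next
  case (9 i j \<phi>)
  have "node_formula \<nu> i (Globally \<phi>)" by (rule node_formula.intros) fact+
  with 9 show ?case by fastforce
qed

text \<open>The map from nodes to formulas covers all subformulas of the root. It yields only an
  inequality: nodes may carry equal formulas or be unreachable from the root.\<close>

lemma ltl_size_decode_le:
  assumes "psat \<nu> (dag_constraint n)" "1 \<le> n"
  shows "ltl_size (decode n \<nu>) \<le> n"
proof -
  have "node_formula \<nu> n (decode n \<nu>)"
    using node_formula_decode[OF assms(1)] assms(2) by simp
  from subformulas_node_formula[OF this assms(2)]
  have "subformulas (decode n \<nu>) \<subseteq> (\<lambda>i. decode i \<nu>) ` {1..n}"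
    using node_formula_decode[OF assms(1)] by blast
  then have "card (subformulas (decode n \<nu>)) \<le> card {1..n}"
    by (rule surj_card_le[rotated]) simp
  then show ?thesis by (simp add: ltl_size_def)
qed

text \<open>The constraint for the label of a node repeats the lasso semantics of that operator, and
  the children are covered by induction. The position \<open>t\<close> is generalized because
  temporal operators consult children at other positions.\<close>

lemma VY_node_formula:
  assumes "psat \<nu> (word_constraint n u v)" "v \<noteq> []"
    and "node_formula \<nu> i \<phi>" "i \<in> {1..n}" "t < length (u @ v)"
  shows "\<nu> (VY u v i t) \<longleftrightarrow> models (suffix t (lasso_word (u, v))) \<phi>"
proof -
  \<comment> \<open>Positions consulted by a constraint stay inside \<open>uv\<close>, where the
    induction hypotheses are available.\<close>
  have fut: "t' < length (u @ v)" if "t' \<in> future u v t" for t t'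
    using that by (simp add: future_def)
  have btw: "t'' < length (u @ v)"
    if "t' \<in> future u v t" "t'' \<in> between u v t t'" for t t' t''
    using that by (auto simp: future_def between_def split: if_splits)
  have len: "length u < length (u @ v)" using assms(2) by simp
  have sub: "j \<in> {1..n} \<and> i \<in> {2..n}" if "i \<in> {1..n}" "j \<in> {1..<i}" for i j
    using that by auto
  \<comment> \<open>The conjuncts of \<open>word_constraint\<close> are separated in the order of
    its definition, one for each kind of label.\<close>
  note W = assms(1)[unfolded word_constraint_def Let_def psat.simps psat_word_constraint
      psat_big_or[OF finite_future] psat_big_and[OF finite_future] psat_big_and[OF finite_between]]
  note W_prop = W[THEN conjunct1]
    and W_neg = W[THEN conjunct2, THEN conjunct1]
    and W_disj = W[THEN conjunct2, THEN conjunct2, THEN conjunct1]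
    and W_conj = W[THEN conjunct2, THEN conjunct2, THEN conjunct2, THEN conjunct1]
    and W_rest = W[THEN conjunct2, THEN conjunct2, THEN conjunct2, THEN conjunct2]
  note W_impl = W_rest[THEN conjunct1]
    and W_next = W_rest[THEN conjunct2, THEN conjunct1]
    and W_until = W_rest[THEN conjunct2, THEN conjunct2, THEN conjunct1]
    and W_finally = W_rest[THEN conjunct2, THEN conjunct2, THEN conjunct2, THEN conjunct1]
    and W_globally = W_rest[THEN conjunct2, THEN conjunct2, THEN conjunct2, THEN conjunct2]
  show ?thesis
    using assms(3-5)
  proof (induction arbitrary: t rule: node_formula.induct)
    case (1 i p)
    then show ?case
      using W_prop models_at_prop[OF "1.prems"(2)] by metis
  next
    case (2 i j \<phi>)
    note sub = sub[OF "2.prems"(1) "2.hyps"(2)]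
    note IH = "2.IH"[OF sub[THEN conjunct1]]
    have "\<nu> (VY u v i t) \<longleftrightarrow>
        \<not> \<nu> (VY u v j t)"
      using W_neg "2.hyps" "2.prems"(2) sub by blast
    then show ?case using IH "2.prems"(2) by simp
  next
    case (3 i j \<phi> j' \<psi>)
    note sub = sub[OF "3.prems"(1) "3.hyps"(2)] sub[OF "3.prems"(1) "3.hyps"(5)]
    note IH = "3.IH"(1)[OF sub(1)[THEN conjunct1]] "3.IH"(2)[OF sub(2)[THEN conjunct1]]
    have "\<nu> (VY u v i t) \<longleftrightarrow>
        \<nu> (VY u v j t) \<or> \<nu> (VY u v j' t)"
      using W_disj "3.hyps" "3.prems"(2) sub by blast
    then show ?case using IH "3.prems"(2) by simp
  next
    case (4 i j \<phi> j' \<psi>)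
    note sub = sub[OF "4.prems"(1) "4.hyps"(2)] sub[OF "4.prems"(1) "4.hyps"(5)]
    note IH = "4.IH"(1)[OF sub(1)[THEN conjunct1]] "4.IH"(2)[OF sub(2)[THEN conjunct1]]
    have "\<nu> (VY u v i t) \<longleftrightarrow>
        \<nu> (VY u v j t) \<and> \<nu> (VY u v j' t)"
      using W_conj "4.hyps" "4.prems"(2) sub by blast
    then show ?case using IH "4.prems"(2) by simp
  next
    case (5 i j \<phi> j' \<psi>)
    note sub = sub[OF "5.prems"(1) "5.hyps"(2)] sub[OF "5.prems"(1) "5.hyps"(5)]
    note IH = "5.IH"(1)[OF sub(1)[THEN conjunct1]] "5.IH"(2)[OF sub(2)[THEN conjunct1]]
    have "\<nu> (VY u v i t) \<longleftrightarrow>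
        (\<nu> (VY u v j t) \<longrightarrow> \<nu> (VY u v j' t))"
      using W_impl "5.hyps" "5.prems"(2) sub by blast
    then show ?case using IH "5.prems"(2) by simp
  next
    case (6 i j \<phi>)
    note sub = sub[OF "6.prems"(1) "6.hyps"(2)]
    note IH = "6.IH"[OF sub[THEN conjunct1]]
    have "\<nu> (VY u v i t) \<longleftrightarrow>
        \<nu> (VY u v j (if t + 1 < length (u @ v) then t + 1 else length u))"
      using W_next "6.hyps" "6.prems"(2) sub by blast
    \<comment> \<open>The wrapped position \<open>length u\<close> lies inside \<open>uv\<close>
      because \<open>v\<close> is nonempty.\<close>
    also have "\<dots> \<longleftrightarrow> models
        (suffix (if t + 1 < length (u @ v) then t + 1 else length u) (lasso_word (u, v))) \<phi>"
      by (rule IH) (use len in simp)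
    finally show ?case
      using models_at_next[OF "6.prems"(2)] by blast
  next
    case (7 i j \<phi> j' \<psi>)
    note sub = sub[OF "7.prems"(1) "7.hyps"(2)] sub[OF "7.prems"(1) "7.hyps"(5)]
    note IH = "7.IH"(1)[OF sub(1)[THEN conjunct1]] "7.IH"(2)[OF sub(2)[THEN conjunct1]]
    have "\<nu> (VY u v i t) \<longleftrightarrow>
        (\<exists>t'\<in>future u v t. \<nu> (VY u v j' t') \<and> (\<forall>t''\<in>between u v t t'. \<nu> (VY u v j t'')))"
      using W_until "7.hyps" "7.prems"(2) sub by blast
    then show ?case
      unfolding models_at_until[OF assms(2) "7.prems"(2)]
      using IH fut btw by metis
  next
    case (8 i j \<phi>)
    note sub = sub[OF "8.prems"(1) "8.hyps"(2)]
    note IH = "8.IH"[OF sub[THEN conjunct1]]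
    have "\<nu> (VY u v i t) \<longleftrightarrow>
        (\<exists>t'\<in>future u v t. \<nu> (VY u v j t'))"
      using W_finally "8.hyps" "8.prems"(2) sub by blast
    then show ?case
      unfolding models_at_finally[OF assms(2) "8.prems"(2)]
      using IH fut by metis
  next
    case (9 i j \<phi>)
    note sub = sub[OF "9.prems"(1) "9.hyps"(2)]
    note IH = "9.IH"[OF sub[THEN conjunct1]]
    have "\<nu> (VY u v i t) \<longleftrightarrow>
        (\<forall>t'\<in>future u v t. \<nu> (VY u v j t'))"
      using W_globally "9.hyps" "9.prems"(2) sub by blast
    then show ?case
      unfolding models_at_globally[OF assms(2) "9.prems"(2)]
      using IH fut by metis
  qed
qed

text \<open>The sample hypothesis supplies the finiteness of \<open>P\<close> and \<open>N\<close>
  on which \<open>psat_big_and\<close> depends.\<close>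

lemma psat_encoding:
  assumes "is_sample (P, N)"
  shows "psat \<nu> (encoding n (P, N)) \<longleftrightarrow>
    psat \<nu> (dag_constraint n) \<and>
    (\<forall>(u, v)\<in>P. psat \<nu> (word_constraint n u v) \<and> \<nu> (VY u v n 0)) \<and>
    (\<forall>(u, v)\<in>N. psat \<nu> (word_constraint n u v) \<and> \<not> \<nu> (VY u v n 0))"
  using assms by (auto simp: split_def)

lemma consistent_decode:
  assumes "is_sample S" "psat \<nu> (encoding n S)" "1 \<le> n"
  shows "consistent (decode n \<nu>) S"
proof -
  obtain P N where S: "S = (P, N)" by fastforce
  note enc = assms(2)[unfolded S psat_encoding[OF assms(1)[unfolded S]]]
  have root: "node_formula \<nu> n (decode n \<nu>)"
    using node_formula_decode enc assms(3) by force
  \<comment> \<open>At position 0 the suffix is the whole word, and 0 is a position of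
    \<open>uv\<close> because \<open>v\<close> is nonempty.\<close>
  have *: "\<nu> (VY u v n 0) \<longleftrightarrow> models (lasso_word (u, v)) (decode n \<nu>)"
    if "(u, v) \<in> P \<union> N" for u v
  proof -
    have "psat \<nu> (word_constraint n u v)" "v \<noteq> []" using that enc assms(1) by (auto simp: S)
    then show ?thesis
      using VY_node_formula[OF _ _ root, of n u v 0] assms(3)
      by (simp del: lasso_word.simps)
  qed
  show ?thesis using enc * by (fastforce simp: S simp del: lasso_word.simps)
qed


section \<open>Completeness of the encoding\<close>

primrec label_of :: "'a ltl \<Rightarrow> 'a label" where
  "label_of (Prop p) = LProp p"
| "label_of (Neg \<phi>) = LNeg"
| "label_of (Disj \<phi> \<psi>) = LDisj"
| "label_of (Conj \<phi> \<psi>) = LConj"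
| "label_of (Impl \<phi> \<psi>) = LImpl"
| "label_of (Next \<phi>) = LNext"
| "label_of (Until \<phi> \<psi>) = LUntil"
| "label_of (Finally \<phi>) = LFinally"
| "label_of (Globally \<phi>) = LGlobally"

text \<open>A proposition is its own child, and a unary formula has its argument on both sides, so
  that \<open>left\<close> and \<open>right\<close> never leave the set of subformulas.\<close>

primrec left :: "'a ltl \<Rightarrow> 'a ltl" where
  "left (Prop p) = Prop p"
| "left (Neg \<phi>) = \<phi>"
| "left (Disj \<phi> \<psi>) = \<phi>"
| "left (Conj \<phi> \<psi>) = \<phi>"
| "left (Impl \<phi> \<psi>) = \<phi>"
| "left (Next \<phi>) = \<phi>"
| "left (Until \<phi> \<psi>) = \<phi>"
| "left (Finally \<phi>) = \<phi>"
| "left (Globally \<phi>) = \<phi>"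

primrec right :: "'a ltl \<Rightarrow> 'a ltl" where
  "right (Prop p) = Prop p"
| "right (Neg \<phi>) = \<phi>"
| "right (Disj \<phi> \<psi>) = \<psi>"
| "right (Conj \<phi> \<psi>) = \<psi>"
| "right (Impl \<phi> \<psi>) = \<psi>"
| "right (Next \<phi>) = \<phi>"
| "right (Until \<phi> \<psi>) = \<psi>"
| "right (Finally \<phi>) = \<phi>"
| "right (Globally \<phi>) = \<phi>"

text \<open>Recovers the constructor from a label, so that the label variables of a valuation
  determine the shape of the formula.\<close>

lemma label_of_eq:
  "label_of \<phi> = LProp p \<longleftrightarrow> \<phi> = Prop p"
  "label_of \<phi> = LNeg \<longleftrightarrow> \<phi> = Neg (left \<phi>)"
  "label_of \<phi> = LDisj \<longleftrightarrow> \<phi> = Disj (left \<phi>) (right \<phi>)"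
  "label_of \<phi> = LConj \<longleftrightarrow> \<phi> = Conj (left \<phi>) (right \<phi>)"
  "label_of \<phi> = LImpl \<longleftrightarrow> \<phi> = Impl (left \<phi>) (right \<phi>)"
  "label_of \<phi> = LNext \<longleftrightarrow> \<phi> = Next (left \<phi>)"
  "label_of \<phi> = LUntil \<longleftrightarrow> \<phi> = Until (left \<phi>) (right \<phi>)"
  "label_of \<phi> = LFinally \<longleftrightarrow> \<phi> = Finally (left \<phi>)"
  "label_of \<phi> = LGlobally \<longleftrightarrow> \<phi> = Globally (left \<phi>)"
  by (cases \<phi>; simp)+

lemma subformulas_refl: "\<phi> \<in> subformulas \<phi>"
  by (cases \<phi>) auto

lemma finite_subformulas: "finite (subformulas \<phi>)"
  by (induction \<phi>) auto

lemma children_subformulas: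
  "\<psi> \<in> subformulas \<phi> \<Longrightarrow> left \<psi> \<in> subformulas \<phi> \<and> right \<psi> \<in> subformulas \<phi>"
  by (induction \<phi>) (auto simp: subformulas_refl)

lemma size_children:
  "label_of \<phi> \<notin> range LProp \<Longrightarrow> size (left \<phi>) < size \<phi> \<and> size (right \<phi>) < size \<phi>"
  by (cases \<phi>) auto

lemma size_subformulas: "\<psi> \<in> subformulas \<phi> \<Longrightarrow> \<psi> = \<phi> \<or> size \<psi> < size \<phi>"
  by (induction \<phi>) auto

text \<open>Sorting the distinct subformulas by datatype \<open>size\<close> puts whatever is
  smaller than \<open>f i\<close> strictly before \<open>i\<close>. The formula itself exceeds all
  its proper subformulas and so comes last.\<close>

lemma subformulas_enumeration:
  fixes \<phi> :: "'a ltl"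
  obtains f where "f ` {1..ltl_size \<phi>} = subformulas \<phi>" "f (ltl_size \<phi>) = \<phi>"
    "\<And>i \<psi>. i \<in> {1..ltl_size \<phi>} \<Longrightarrow> \<psi> \<in> subformulas \<phi> \<Longrightarrow> size \<psi> < size (f i) \<Longrightarrow>
       \<exists>j\<in>{1..<i}. f j = \<psi>"
proof -
  obtain ys where ys: "set ys = subformulas \<phi>" "distinct ys"
    using finite_distinct_list[OF finite_subformulas] by blast
  define xs where "xs = sort_key size ys"
  have set: "set xs = subformulas \<phi>" and "distinct xs" and sorted: "sorted (map size xs)"
    using ys by (simp_all add: xs_def)
  then have len: "length xs = ltl_size \<phi>"
    unfolding ltl_size_def by (metis distinct_card)
  \<comment> \<open>Nodes count from 1, list positions from 0.\<close>
  define f where "f = (\<lambda>i. xs ! (i - 1))"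
  have mono: "size (f i) \<le> size (f j)" if "i \<le> j" "j \<in> {1..ltl_size \<phi>}" for i j
    using sorted_nth_mono[OF sorted diff_le_mono[OF that(1)], of 1] that len
    by (simp add: f_def less_eq_Suc_le)
  have img: "f ` {1..ltl_size \<phi>} = subformulas \<phi>"
  proof
    show "f ` {1..ltl_size \<phi>} \<subseteq> subformulas \<phi>"
      using nth_mem[of _ xs] by (intro image_subsetI) (simp add: f_def set len less_eq_Suc_le)
    show "subformulas \<phi> \<subseteq> f ` {1..ltl_size \<phi>}"
    proof
      fix \<psi> assume "\<psi> \<in> subformulas \<phi>"
      then obtain i where "i < length xs" "xs ! i = \<psi>"
        using set by (metis in_set_conv_nth)
      then show "\<psi> \<in> f ` {1..ltl_size \<phi>}"
        using len by (intro image_eqI[of _ _ "Suc i"]) (auto simp: f_def)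
    qed
  qed
  have children: "\<exists>j\<in>{1..<i}. f j = \<psi>"
    if i: "i \<in> {1..ltl_size \<phi>}" and \<psi>: "\<psi> \<in> subformulas \<phi>" "size \<psi> < size (f i)" for i \<psi>
  proof -
    obtain j where j: "j \<in> {1..ltl_size \<phi>}" "f j = \<psi>"
      using \<psi>(1) by (metis img imageE)
    have "j < i"
    proof (rule ccontr)
      assume "\<not> j < i"
      then have "size (f i) \<le> size (f j)"
        using mono j(1) by simp
      with j \<psi> show False by simp
    qed
    with j show ?thesis by auto
  qed
  have n: "ltl_size \<phi> \<in> {1..ltl_size \<phi>}"
    using img subformulas_refl[of \<phi>] by fastforce
  then have "f (ltl_size \<phi>) \<in> subformulas \<phi>" using img by blast
  \<comment> \<open>The last entry is at least as large as any other, in particular as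
    \<open>\<phi>\<close>; \<open>size_subformulas\<close> then leaves only \<open>\<phi>\<close>
    itself.\<close>
  moreover have "\<not> size (f (ltl_size \<phi>)) < size \<phi>"
  proof
    assume "size (f (ltl_size \<phi>)) < size \<phi>"
    moreover obtain j where j: "j \<in> {1..ltl_size \<phi>}" "f j = \<phi>"
      using subformulas_refl[of \<phi>] by (metis img imageE)
    ultimately show False
      using mono[of j "ltl_size \<phi>"] n by auto
  qed
  ultimately have "f (ltl_size \<phi>) = \<phi>" using size_subformulas by blast
  with img show ?thesis using children by (rule that)
qed

text \<open>The variables \<open>VY\<close> receive the true semantics, so that every word
  constraint becomes a fact about lassos.\<close>

primrec dag_valuation ::
  "(nat \<Rightarrow> 'a ltl) \<Rightarrow> (nat \<Rightarrow> nat) \<Rightarrow> (nat \<Rightarrow> nat) \<Rightarrow> 'a enc_var \<Rightarrow> bool" where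
  "dag_valuation f l r (VX i k) \<longleftrightarrow> k = label_of (f i)"
| "dag_valuation f l r (VL i j) \<longleftrightarrow> j = l i"
| "dag_valuation f l r (VR i j) \<longleftrightarrow> j = r i"
| "dag_valuation f l r (VY u v i t) \<longleftrightarrow> models (suffix t (lasso_word (u, v))) (f i)"

lemma psat_word_constraint_dag_valuation:
  fixes f :: "nat \<Rightarrow> 'a::finite ltl"
  assumes "v \<noteq> []"
    and l: "\<And>i. i \<in> {2..n} \<Longrightarrow> label_of (f i) \<notin> range LProp \<Longrightarrow> f (l i) = left (f i)"
    and r: "\<And>i. i \<in> {2..n} \<Longrightarrow> label_of (f i) \<notin> range LProp \<Longrightarrow> f (r i) = right (f i)"
  shows "psat (dag_valuation f l r) (word_constraint n u v)"
proof -
  have *: "f i = Prop p" if "LProp p = label_of (f i)" for i p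
    using that label_of_eq(1) by metis
  \<comment> \<open>The parameter \<open>c\<close> stands for a unary constructor, in
    \<open>bin\<close> for a binary one; \<open>label_of_eq\<close> discharges the last
    premise.\<close>
  have un: "f i = c (f j)"
    if "i \<in> {2..n}" "j = l i" "k = label_of (f i)" "k \<notin> range LProp"
      "\<And>\<phi>. label_of \<phi> = k \<longleftrightarrow> \<phi> = c (left \<phi>)" for c i j k
    using that l[of i] by metis
  have bin: "f i = c (f j) (f j')"
    if "i \<in> {2..n}" "j = l i" "j' = r i" "k = label_of (f i)" "k \<notin> range LProp"
      "\<And>\<phi>. label_of \<phi> = k \<longleftrightarrow> \<phi> = c (left \<phi>) (right \<phi>)" for c i j j' k
    using that l[of i] r[of i] by metis
  let ?w = "lasso_word (u, v)"
  show ?thesis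
    unfolding word_constraint_def Let_def psat.simps psat_word_constraint dag_valuation.simps
  \<comment> \<open>One goal arises for each kind of label, in the order of
    \<open>word_constraint\<close>.\<close>
  proof (intro conjI ballI allI impI; (elim conjE)?)
    fix i t p
    assume "LProp p = label_of (f i)" "t < length (u @ v)"
    then show "models (suffix t ?w) (f i) \<longleftrightarrow> p \<in> (u @ v) ! t"
      using * models_at_prop by metis
  next
    fix i j t
    assume "i \<in> {2..n}" "LNeg = label_of (f i)" "j = l i"
    then have "f i = Neg (f j)" by (intro un) (auto simp: label_of_eq)
    then show "models (suffix t ?w) (f i) \<longleftrightarrow> \<not> models (suffix t ?w) (f j)" by simp
  next
    fix i j j' t
    assume "i \<in> {2..n}" "LDisj = label_of (f i)" "j = l i" "j' = r i"
    then have "f i = Disj (f j) (f j')" by (intro bin) (auto simp: label_of_eq)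
    then show "models (suffix t ?w) (f i) \<longleftrightarrow>
      models (suffix t ?w) (f j) \<or> models (suffix t ?w) (f j')" by simp
  next
    fix i j j' t
    assume "i \<in> {2..n}" "LConj = label_of (f i)" "j = l i" "j' = r i"
    then have "f i = Conj (f j) (f j')" by (intro bin) (auto simp: label_of_eq)
    then show "models (suffix t ?w) (f i) \<longleftrightarrow>
      models (suffix t ?w) (f j) \<and> models (suffix t ?w) (f j')" by simp
  next
    fix i j j' t
    assume "i \<in> {2..n}" "LImpl = label_of (f i)" "j = l i" "j' = r i"
    then have "f i = Impl (f j) (f j')" by (intro bin) (auto simp: label_of_eq)
    then show "models (suffix t ?w) (f i) \<longleftrightarrow>
      (models (suffix t ?w) (f j) \<longrightarrow> models (suffix t ?w) (f j'))" by simp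
  next
    fix i j t
    assume "i \<in> {2..n}" "LNext = label_of (f i)" "j = l i" and t: "t < length (u @ v)"
    then have "f i = Next (f j)" by (intro un) (auto simp: label_of_eq)
    then show "models (suffix t ?w) (f i) \<longleftrightarrow>
      models (suffix (if t + 1 < length (u @ v) then t + 1 else length u) ?w) (f j)"
      using models_at_next[OF t] by metis
  next
    fix i j j' t
    assume "i \<in> {2..n}" "LUntil = label_of (f i)" "j = l i" "j' = r i"
      and t: "t < length (u @ v)"
    then have "f i = Until (f j) (f j')" by (intro bin) (auto simp: label_of_eq)
    then show "models (suffix t ?w) (f i) \<longleftrightarrow> psat (dag_valuation f l r)
      (\<^bold>\<Or>t'\<in>future u v t. PVar (VY u v j' t') \<^bold>\<and>
         (\<^bold>\<And>t''\<in>between u v t t'. PVar (VY u v j t'')))"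
      using models_at_until[OF assms(1) t] by (simp del: models.simps lasso_word.simps)
  next
    fix i j t
    assume "i \<in> {2..n}" "LFinally = label_of (f i)" "j = l i" and t: "t < length (u @ v)"
    then have "f i = Finally (f j)" by (intro un) (auto simp: label_of_eq)
    then show "models (suffix t ?w) (f i) \<longleftrightarrow>
      psat (dag_valuation f l r) (\<^bold>\<Or>t'\<in>future u v t. PVar (VY u v j t'))"
      using models_at_finally[OF assms(1) t] by (simp del: models.simps lasso_word.simps)
  next
    fix i j t
    assume "i \<in> {2..n}" "LGlobally = label_of (f i)" "j = l i" and t: "t < length (u @ v)"
    then have "f i = Globally (f j)" by (intro un) (auto simp: label_of_eq)
    then show "models (suffix t ?w) (f i) \<longleftrightarrow>
      psat (dag_valuation f l r) (\<^bold>\<And>t'\<in>future u v t. PVar (VY u v j t'))"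
      using models_at_globally[OF assms(1) t] by (simp del: models.simps lasso_word.simps)
  qed
qed

lemma ltl_size_pos: "1 \<le> ltl_size \<phi>"
  using subformulas_refl[of \<phi>] finite_subformulas[of \<phi>]
  by (auto simp: ltl_size_def Suc_le_eq card_gt_0_iff)

lemma encoding_satisfiable:
  fixes S :: "'a::finite sample"
  assumes "is_sample S" "consistent \<phi> S"
  shows "\<exists>\<nu>. psat \<nu> (encoding (ltl_size \<phi>) S)"
proof -
  obtain P N where S: "S = (P, N)" by fastforce
  define n where "n = ltl_size \<phi>"
  obtain f where img: "f ` {1..n} = subformulas \<phi>" and root: "f n = \<phi>"
    and smaller: "\<And>i \<psi>. i \<in> {1..n} \<Longrightarrow> \<psi> \<in> subformulas \<phi> \<Longrightarrow> size \<psi> < size (f i) \<Longrightarrow>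
       \<exists>j\<in>{1..<i}. f j = \<psi>"
    unfolding n_def by (rule subformulas_enumeration) blast
  \<comment> \<open>Children are subformulas of strictly smaller size, so the enumeration lists them
    earlier.\<close>
  have L: "\<exists>j\<in>{1..<i}. f j = left (f i)" and R: "\<exists>j\<in>{1..<i}. f j = right (f i)"
    if "i \<in> {1..n}" "label_of (f i) \<notin> range LProp" for i
    using smaller[OF that(1)] children_subformulas[of "f i" \<phi>] img that size_children[OF that(2)]
    by blast+
  \<comment> \<open>The DAG constraint demands children of propositions too, except at node 1; the
    default is node 1, admissible because \<open>i\<close> is at least 2.\<close>
  have "\<exists>j\<in>{1..<i}. label_of (f i) \<notin> range LProp \<longrightarrow> f j = left (f i)" if "i \<in> {2..n}" for i
    by (cases "label_of (f i) \<in> range LProp") (use that L[of i] in \<open>auto intro!: bexI[of _ 1]\<close>)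
  then have "\<forall>i\<in>{2..n}. \<exists>j. j \<in> {1..<i} \<and> (label_of (f i) \<notin> range LProp \<longrightarrow> f j = left (f i))"
    by blast
  from bchoice[OF this] obtain l where
    l: "\<And>i. i \<in> {2..n} \<Longrightarrow> l i \<in> {1..<i} \<and> (label_of (f i) \<notin> range LProp \<longrightarrow> f (l i) = left (f i))"
    by blast
  have "\<exists>j\<in>{1..<i}. label_of (f i) \<notin> range LProp \<longrightarrow> f j = right (f i)" if "i \<in> {2..n}" for i
    by (cases "label_of (f i) \<in> range LProp") (use that R[of i] in \<open>auto intro!: bexI[of _ 1]\<close>)
  then have "\<forall>i\<in>{2..n}. \<exists>j. j \<in> {1..<i} \<and> (label_of (f i) \<notin> range LProp \<longrightarrow> f j = right (f i))"
    by blast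
  from bchoice[OF this] obtain r where
    r: "\<And>i. i \<in> {2..n} \<Longrightarrow> r i \<in> {1..<i} \<and> (label_of (f i) \<notin> range LProp \<longrightarrow> f (r i) = right (f i))"
    by blast
  have n1: "1 \<in> {1..n}" using ltl_size_pos[of \<phi>] by (simp add: n_def)
  \<comment> \<open>Any other label would require a child in the empty range
    \<open>{1..<1}\<close>.\<close>
  have "label_of (f 1) \<in> range LProp"
    using L[OF n1] by auto
  then have "psat (dag_valuation f l r) (dag_constraint n)"
    unfolding psat_dag_constraint dag_valuation.simps using l r by auto
  moreover have "psat (dag_valuation f l r) (word_constraint n u v)" if "(u, v) \<in> P \<union> N" for u v
    proof (rule psat_word_constraint_dag_valuation)
    show "v \<noteq> []" using that assms(1) by (auto simp: S)
  qed (use l r in auto)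
  ultimately have "psat (dag_valuation f l r) (encoding n S)"
    using assms(2) unfolding S psat_encoding[OF assms(1)[unfolded S]]
    by (auto simp: root simp del: lasso_word.simps)
  then show ?thesis unfolding n_def by blast
qed


section \<open>Existence of a consistent formula\<close>

lemma models_Next_power: "models w ((Next ^^ k) \<phi>) \<longleftrightarrow> models (suffix k w) \<phi>"
  by (induction k arbitrary: w) auto

lemma separate_words:
  fixes w w' :: "'a set word"
  assumes "w \<noteq> w'"
  shows "\<exists>\<phi>. models w \<phi> \<and> \<not> models w' \<phi>"
proof -
  obtain k where "w k \<noteq> w' k" using assms by blast
  then obtain p where "(p \<in> w k) \<noteq> (p \<in> w' k)" by blast
  moreover have "models x ((Next ^^ k) (Prop p)) \<longleftrightarrow> p \<in> x k" for x
    by (simp add: models_Next_power)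
  \<comment> \<open>Either this formula or its negation, according to which word has
    \<open>p\<close> at \<open>k\<close>.\<close>
  ultimately show ?thesis by (metis models.simps(2))
qed

lemma finite_conjunction:
  fixes f :: "'i \<Rightarrow> 'a ltl"
  assumes "finite I"
  shows "\<exists>\<phi>. \<forall>w. models w \<phi> \<longleftrightarrow> (\<forall>i\<in>I. models w (f i))"
  using assms
proof (induction I)
  case empty
  \<comment> \<open>The empty conjunction must hold everywhere; \<open>undefined\<close> is some
    proposition, put into a tautology.\<close>
  show ?case by (rule exI[of _ "Impl (Prop undefined) (Prop undefined)"]) simp
next
  case (insert i I)
  then obtain \<phi> where "\<forall>w. models w \<phi> \<longleftrightarrow> (\<forall>i\<in>I. models w (f i))" by blast
  then show ?case by (intro exI[of _ "Conj (f i) \<phi>"]) simp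
qed

text \<open>The formula is a disjunction over \<open>x\<close> in \<open>A\<close> of conjunctions
  \<open>c x\<close>, over \<open>y\<close> in \<open>B\<close>, of formulas separating
  \<open>x\<close> from \<open>y\<close>. Writing the disjunction as a negated conjunction of
  negations lets \<open>finite_conjunction\<close> serve both levels.\<close>

lemma separate_word_sets:
  fixes A B :: "'a set word set"
  assumes "finite A" "finite B" "A \<inter> B = {}"
  shows "\<exists>\<phi>. (\<forall>w\<in>A. models w \<phi>) \<and> (\<forall>w\<in>B. \<not> models w \<phi>)"
proof -
  have "\<forall>w w' :: 'a set word. \<exists>\<phi>. w \<noteq> w' \<longrightarrow> models w \<phi> \<and> \<not> models w' \<phi>"
    using separate_words by blast
  then obtain s :: "'a set word \<Rightarrow> 'a set word \<Rightarrow> 'a ltl"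
    where s: "\<And>w w'. w \<noteq> w' \<Longrightarrow> models w (s w w') \<and> \<not> models w' (s w w')"
    by metis
  obtain c :: "'a set word \<Rightarrow> 'a ltl"
    where c: "\<And>x w. models w (c x) \<longleftrightarrow> (\<forall>y\<in>B. models w (s x y))"
  proof -
    have "\<forall>x. \<exists>\<phi>. \<forall>w. models w \<phi> \<longleftrightarrow> (\<forall>y\<in>B. models w (s x y))"
      using finite_conjunction[OF assms(2)] by blast
    from choice[OF this] show ?thesis using that by blast
  qed
  obtain d :: "'a ltl" where d: "\<And>w. models w d \<longleftrightarrow> (\<forall>x\<in>A. models w (Neg (c x)))"
    using finite_conjunction[OF assms(1), of "\<lambda>x. Neg (c x)"] by blast
  have "w \<noteq> w'" if "w \<in> A" "w' \<in> B" for w w'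
    using that assms(3) by blast
  \<comment> \<open>A word \<open>w\<close> in \<open>A\<close> satisfies its own
    \<open>c w\<close>; a word \<open>w\<close> in \<open>B\<close> refutes the conjunct
    \<open>s x w\<close> of \<open>c x\<close> for every \<open>x\<close> in
    \<open>A\<close>.\<close>
  then have "\<forall>w\<in>A. \<not> models w d" "\<forall>w\<in>B. models w d"
    unfolding c d models.simps using s by blast+
  then show ?thesis by (intro exI[of _ "Neg d"]) simp
qed

lemma consistent_formula_exists:
  assumes "is_sample S"
  shows "\<exists>\<phi>. consistent \<phi> S"
proof -
  obtain P N where S: "S = (P, N)" by fastforce
  \<comment> \<open>Separation is applied to the words, which \<open>is_sample\<close> makes
    disjoint, and not to their representations.\<close>
  have "\<exists>\<phi>. (\<forall>w\<in>lasso_word ` P. models w \<phi>) \<and> (\<forall>w\<in>lasso_word ` N. \<not> models w \<phi>)"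
    by (rule separate_word_sets) (use assms in \<open>simp_all add: S\<close>)
  then show ?thesis by (simp add: S)
qed


section \<open>The learning algorithm\<close>

text \<open>Induction downwards from \<open>n'\<close>: each answer \<open>None\<close> costs one
  unfolding of the loop, so the loop ends after finitely many.\<close>

lemma learn_from_first_model:
  assumes "\<And>m. n \<le> m \<Longrightarrow> m < n' \<Longrightarrow> solve (encoding m S) = None"
    and "solve (encoding n' S) = Some \<nu>" and "n \<le> n'"
  shows "learn_from solve S n = Some (decode n' \<nu>)"
  using assms(3,1)
proof (induction n rule: inc_induct)
  case base
  show ?case using assms(2) by (subst learn_from.simps) simp
next
  case (step m)
  have "learn_from solve S (Suc m) = Some (decode n' \<nu>)"
    using step.prems by (intro step.IH) simp
  then show ?case using step.prems step.hyps by (subst learn_from.simps) simp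
qed

theorem theorem1:
  fixes S :: "'a::finite sample"
    and solve :: "'a enc_var pform \<Rightarrow> ('a enc_var \<Rightarrow> bool) option"
  assumes "is_sample S"
    and "correct_solver solve"
  shows "\<exists>\<psi>. learn solve S = Some \<psi> \<and> consistent \<psi> S \<and>
           (\<forall>\<phi>. consistent \<phi> S \<longrightarrow> ltl_size \<psi> \<le> ltl_size \<phi>)"
proof -
  \<comment> \<open>The bound \<open>1 \<le> n\<close> matches the start of the loop; at 0 the node
    ranges are empty and a model need not describe a DAG.\<close>
  define sat where "sat = (\<lambda>n. 1 \<le> n \<and> (\<exists>\<nu>. psat \<nu> (encoding n S)))"
  have sat: "sat (ltl_size \<phi>)" if "consistent \<phi> S" for \<phi>
    using encoding_satisfiable[OF assms(1) that] ltl_size_pos by (simp add: sat_def)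
  define n where "n = (LEAST n. sat n)"
  \<comment> \<open>Termination rests on this: a consistent formula exists, and its size is an index
    with a satisfiable encoding.\<close>
  have "sat n"
    unfolding n_def using consistent_formula_exists[OF assms(1)] sat LeastI by metis
  have solve_None: "solve \<Phi> = None \<longleftrightarrow> \<not> (\<exists>\<nu>. psat \<nu> \<Phi>)" for \<Phi>
    using assms(2) unfolding correct_solver_def
    by (cases "solve \<Phi>") (auto split: option.splits dest: spec[of _ \<Phi>])
  obtain \<nu> where \<nu>: "solve (encoding n S) = Some \<nu>"
    using \<open>sat n\<close> solve_None by (auto simp: sat_def)
  then have model: "psat \<nu> (encoding n S)"
    using assms(2) unfolding correct_solver_def by (metis option.case(2))
  have n: "1 \<le> n" using \<open>sat n\<close> by (simp add: sat_def)
  have "learn solve S = Some (decode n \<nu>)"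
    unfolding learn_def
  proof (rule learn_from_first_model)
    show "solve (encoding n S) = Some \<nu>" "1 \<le> n" by fact+
    \<comment> \<open>Below the least index the encodings are unsatisfiable, so a correct solver
      answers \<open>None\<close>.\<close>
    fix m assume "1 \<le> m" "m < n"
    then show "solve (encoding m S) = None"
      using not_less_Least[of m sat] solve_None by (simp add: n_def sat_def)
  qed
  moreover have "consistent (decode n \<nu>) S"
    by (rule consistent_decode[OF assms(1) model n])
  \<comment> \<open>The index \<open>n\<close> lies between the two sizes: \<open>n\<close> nodes
    carry at most \<open>n\<close> formulas, and the size of any consistent \<open>\<phi>\<close> is
    itself a satisfiable index.\<close>
  moreover have "ltl_size (decode n \<nu>) \<le> ltl_size \<phi>" if "consistent \<phi> S" for \<phi>
  proof -
    have "psat \<nu> (dag_constraint n)" using model by (cases S) simp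
    then have "ltl_size (decode n \<nu>) \<le> n" using n by (rule ltl_size_decode_le)
    also have "n \<le> ltl_size \<phi>"
      unfolding n_def using sat[OF that] by (rule Least_le)
    finally show ?thesis .
  qed
  ultimately show ?thesis by blast
qed

end
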